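(* Let $X$ be a topological space that is semi-stratifiable over $\alpha$ for some ordinal $\alpha$. Then $X$ is a $D$-space.
   Context: **$D$-space.** An open neighborhood assignment (ONA) on a space $(X,\tau)$ is a function $N : X \to \tau$ such that $x \in N(x)$ for all $x \in X$. The space $X$ is a $D$-space iff for every ONA $N$ on $X$ there is a closed discrete subset $D$ of $X$ (closed in $X$, and discrete in the subspace topology) such that $\{N(d) : d \in D\}$ covers $X$. **Semi-stratifiable over $\alpha$.** Let $(X,\tau)$ be a $T_1$-space, let $\mathcal{F}_X$ denote the family of all closed subsets of $X$, and let $\alpha$ be an ordinal. $X$ is semi-stratifiable over $\alpha$ (also: linearly semi-stratifiable) if there exists a mapping $F : \tau \times \alpha \to \mathcal{F}_X$ such that: (1) $U = \bigcup\{F(U,\beta) : \beta < \alpha\}$ for all $U \in \tau$; (2) if $U, W \in \tau$ and $U \subseteq W$, then $F(U,\beta) \subseteq F(W,\beta)$ for all $\beta < \alpha$; (3) if $\gamma < \beta < \alpha$, then $F(U,\gamma) \subseteq F(U,\beta)$ for all $U \in \tau$. The $T_1$ axiom is part of the definition. *)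

theory Defs
  imports "HOL-Analysis.T1_Spaces"
begin

definition ONA :: "'a topology \<Rightarrow> ('a \<Rightarrow> 'a set) \<Rightarrow> bool" where
  "ONA X N \<longleftrightarrow> (\<forall>x \<in> topspace X. openin X (N x) \<and> x \<in> N x)"

definition D_space :: "'a topology \<Rightarrow> bool" where
  "D_space X \<longleftrightarrow>
     (\<forall>N. ONA X N \<longrightarrow>
        (\<exists>D. closedin X D \<and> subtopology X D = discrete_topology D \<and>
             topspace X \<subseteq> (\<Union>d\<in>D. N d)))"

text \<open>
  An ordinal \<open>\<alpha>\<close> is given by a reflexive well-order \<open>r\<close> of that order type, on a subset
  of an arbitrary type: the ordinals \<open>\<beta> < \<alpha>\<close> are the elements of \<open>Field r\<close>, and
  \<open>\<gamma> < \<beta>\<close> is \<open>(\<gamma>, \<beta>) \<in> r - Id\<close>. The empty relation is the ordinal 0.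
  Values of \<open>F\<close> outside the open sets and \<open>Field r\<close> are irrelevant.
\<close>
definition semi_stratifiable_over :: "'a topology \<Rightarrow> 'b rel \<Rightarrow> bool" where
  "semi_stratifiable_over X r \<longleftrightarrow>
     t1_space X \<and>
     (\<exists>F :: 'a set \<Rightarrow> 'b \<Rightarrow> 'a set.
        (\<forall>U \<beta>. openin X U \<and> \<beta> \<in> Field r \<longrightarrow> closedin X (F U \<beta>)) \<and>
        (\<forall>U. openin X U \<longrightarrow> U = (\<Union>\<beta>\<in>Field r. F U \<beta>)) \<and>
        (\<forall>U W. openin X U \<and> openin X W \<and> U \<subseteq> W \<longrightarrow> (\<forall>\<beta>\<in>Field r. F U \<beta> \<subseteq> F W \<beta>)) \<and>
        (\<forall>\<gamma> \<beta>. (\<gamma>, \<beta>) \<in> r - Id \<longrightarrow> (\<forall>U. openin X U \<longrightarrow> F U \<gamma> \<subseteq> F U \<beta>)))"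

end

theory Submission imports Defs begin

text \<open>
  For a point \<open>x\<close> let \<open>n x\<close> be some \<open>\<beta>\<close> with \<open>x \<in> F (N x) \<beta>\<close>, and let
  \<open>g x\<close> be the open neighbourhood \<open>X - F (X - {x}) (n x)\<close> of \<open>x\<close>. If \<open>x \<notin> N y\<close>, then
  \<open>N y \<subseteq> X - {x}\<close>, so \<open>n y \<le> n x\<close> gives \<open>y \<in> F (X - {x}) (n x)\<close>, that is, \<open>y \<notin> g x\<close>.
  Well-order the points so that \<open>n\<close> is monotone and let \<open>D\<close> be the greedy kernel: \<open>x\<close> is
  picked iff no earlier picked \<open>y\<close> has \<open>x \<in> N y\<close>. Then \<open>N\<close> covers \<open>X\<close> from \<open>D\<close>. If \<open>d\<close> is
  the first point of \<open>D\<close> with \<open>x \<in> N d\<close>, then \<open>N d\<close> contains no later point of \<open>D\<close> and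
  \<open>g x\<close> contains no earlier one, so the neighbourhood \<open>N d \<inter> g x\<close> of \<open>x\<close> meets \<open>D\<close> at most
  in \<open>d\<close>.
\<close>

text \<open>The condition on \<open>x\<close> consults \<open>D\<close> only at
  \<open>R\<close>-predecessors of \<open>x\<close>, so well-founded recursion resolves the
  circularity.\<close>

lemma wf_greedy_kernel:
  assumes "wf R"
  obtains D where "\<And>x. x \<in> D \<longleftrightarrow> x \<in> S \<and> (\<forall>y\<in>D. (y, x) \<in> R \<longrightarrow> x \<notin> N y)"
proof -
  define P where
    "P = wfrec R (\<lambda>f x. x \<in> S \<and> (\<forall>y. (y, x) \<in> R \<longrightarrow> f y \<longrightarrow> x \<notin> N y))"
  have "P x \<longleftrightarrow> x \<in> S \<and> (\<forall>y. (y, x) \<in> R \<longrightarrow> P y \<longrightarrow> x \<notin> N y)" for x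
    unfolding P_def by (subst wfrec[OF assms]) (auto simp: cut_apply)
  then show thesis
    by (intro that[of "Collect P"]) blast
qed

text \<open>In a T1 space every neighbourhood of an accumulation point of \<open>D\<close> meets
  \<open>D\<close> in an infinite set. So the derived set of \<open>D\<close> is empty, which gives
  both closedness and discreteness.\<close>

lemma closed_discrete_if_locally_finite:
  assumes "t1_space X" and "D \<subseteq> topspace X"
    and "\<And>x. x \<in> topspace X \<Longrightarrow> \<exists>V. openin X V \<and> x \<in> V \<and> finite (D \<inter> V)"
  shows "closedin X D" and "subtopology X D = discrete_topology D"
proof -
  have "X derived_set_of D = {}"
    using assms(3) t1_space_derived_set_of_infinite_openin[THEN iffD1, OF assms(1)] by blast
  then show "closedin X D" "subtopology X D = discrete_topology D"
    using assms(2) by (auto simp: closedin_contains_derived_set subtopology_eq_discrete_topology_eq)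
qed

text \<open>This isolates the greedy argument from the stratification, of which only the rank
  \<open>n\<close> and the neighbourhoods \<open>g\<close> remain.\<close>

lemma D_space_if_monotone_rank:
  fixes X :: "'a topology" and r :: "'b rel"
  assumes r: "Well_order r" and t1: "t1_space X"
    and rank: "\<And>N. ONA X N \<Longrightarrow>
      \<exists>n g. \<forall>x\<in>topspace X. n x \<in> Field r \<and> openin X (g x) \<and> x \<in> g x \<and>
        (\<forall>y\<in>topspace X. x \<notin> N y \<longrightarrow> (n y, n x) \<in> r \<longrightarrow> y \<notin> g x)"
  shows "D_space X"
  unfolding D_space_def
proof (intro allI impI)
  fix N assume N: "ONA X N"
  obtain n g where n: "\<And>x. x \<in> topspace X \<Longrightarrow> n x \<in> Field r"
    and g: "\<And>x. x \<in> topspace X \<Longrightarrow> openin X (g x) \<and> x \<in> g x"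
    and sep: "\<And>x y. \<lbrakk>x \<in> topspace X; y \<in> topspace X; x \<notin> N y; (n y, n x) \<in> r\<rbrakk> \<Longrightarrow> y \<notin> g x"
    using rank[OF N] by blast
  obtain s :: "'a rel" where s: "well_order_on UNIV s"
    using well_order_on by blast
  \<comment> \<open>Ties of rank are broken by \<open>s\<close>, so that \<open>R\<close> is total
    on the points while \<open>n\<close> stays weakly increasing along it.\<close>
  define R where "R = inv_image ((r - Id) <*lex*> (s - Id)) (\<lambda>x. (n x, x))"
  have "wf R"
    using r s by (auto simp: R_def well_order_on_def)
  have total: "x = y \<or> (x, y) \<in> R \<or> (y, x) \<in> R" if "x \<in> topspace X" "y \<in> topspace X" for x y
    using r s n[OF that(1)] n[OF that(2)]
    by (auto simp: R_def well_order_on_def linear_order_on_def total_on_def)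
  have refl: "(a, a) \<in> r" if "a \<in> Field r" for a
    using r that by (auto simp: order_on_defs refl_on_def)
  have mono: "(n x, n y) \<in> r" if "(x, y) \<in> R" "x \<in> topspace X" for x y
    using that refl[OF n, of x] by (auto simp: R_def)
  have trans: "trans r"
    using r by (auto simp: order_on_defs)
  obtain D where D: "\<And>x. x \<in> D \<longleftrightarrow> x \<in> topspace X \<and> (\<forall>y\<in>D. (y, x) \<in> R \<longrightarrow> x \<notin> N y)"
    using wf_greedy_kernel[OF \<open>wf R\<close>] by blast
  have D_sub: "D \<subseteq> topspace X"
    using D by blast
  have N': "openin X (N x)" "x \<in> N x" if "x \<in> topspace X" for x
    using N that by (auto simp: ONA_def)
  have first: "\<exists>d\<in>D. x \<in> N d \<and> (n d, n x) \<in> r \<and> (\<forall>y\<in>D. (y, d) \<in> R \<longrightarrow> x \<notin> N y)"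
    if x: "x \<in> topspace X" for x
  proof -
    \<comment> \<open>Either \<open>x\<close> is picked itself, or the greedy rule rejected it
      because of an earlier picked point whose set contains it.\<close>
    have *: "\<exists>d\<in>D. x \<in> N d \<and> (d = x \<or> (d, x) \<in> R)"
      using D[of x] N'(2)[OF x] x by blast
    let ?Q = "{d \<in> D. x \<in> N d \<and> (n d, n x) \<in> r}"
    obtain c where c: "c \<in> ?Q"
      using * mono refl n[OF x] D by blast
    obtain d where d: "d \<in> ?Q" "\<And>y. (y, d) \<in> R \<Longrightarrow> y \<notin> ?Q"
      by (rule wfE_min[OF \<open>wf R\<close> c]) (rule that)
    \<comment> \<open>Minimality holds only within \<open>?Q\<close>, but a point before
      \<open>d\<close> has rank at most \<open>n d\<close>, hence at most \<open>n x\<close>, so the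
      rank condition of \<open>?Q\<close> excludes none of them.\<close>
    have "x \<notin> N y" if "y \<in> D" "(y, d) \<in> R" for y
      using d that mono[OF that(2)] D[of y] transD[OF trans, of "n y" "n d" "n x"] by blast
    then show ?thesis
      using d(1) by blast
  qed
  have "\<exists>V. openin X V \<and> x \<in> V \<and> finite (D \<inter> V)" if x: "x \<in> topspace X" for x
  proof -
    obtain d where d: "d \<in> D" "x \<in> N d" "(n d, n x) \<in> r"
      and min: "\<And>y. y \<in> D \<Longrightarrow> (y, d) \<in> R \<Longrightarrow> x \<notin> N y"
      using first[OF x] by blast
    have "y = d" if y: "y \<in> D" "y \<in> N d" "y \<in> g x" for y
    proof (rule ccontr)
      assume "y \<noteq> d"
      moreover have "(d, y) \<notin> R"
        using D[of y] y d(1) by blast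
      ultimately have "(y, d) \<in> R"
        using total[of y d] D y(1) d(1) by blast
      \<comment> \<open>This bound makes \<open>sep\<close> applicable: earlier points inherit it
        from \<open>d\<close>.\<close>
      moreover from this have "(n y, n x) \<in> r"
        using mono D y(1) d(3) transD[OF trans] by blast
      ultimately show False
        using sep[OF x, of y] min y D by blast
    qed
    then have "D \<inter> (N d \<inter> g x) \<subseteq> {d}"
      by blast
    then have "finite (D \<inter> (N d \<inter> g x))"
      using finite_subset by blast
    moreover have "openin X (N d \<inter> g x)" "x \<in> N d \<inter> g x"
      using N'(1)[of d] g[OF x] D_sub d by auto
    ultimately show ?thesis
      by blast
  qed
  then have "closedin X D" "subtopology X D = discrete_topology D"
    using closed_discrete_if_locally_finite[OF t1 D_sub] by blast+
  moreover have "topspace X \<subseteq> (\<Union>d\<in>D. N d)"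
    using first by blast
  ultimately show "\<exists>D. closedin X D \<and> subtopology X D = discrete_topology D \<and>
      topspace X \<subseteq> (\<Union>d\<in>D. N d)"
    by blast
qed

theorem theorem5p2:
  fixes X :: "'a topology" and r :: "'b rel"
  assumes "Well_order r"
    and "semi_stratifiable_over X r"
  shows "D_space X"
proof -
  obtain F where t1: "t1_space X"
    and F: "\<forall>U \<beta>. openin X U \<and> \<beta> \<in> Field r \<longrightarrow> closedin X (F U \<beta>)"
      "\<forall>U. openin X U \<longrightarrow> U = (\<Union>\<beta>\<in>Field r. F U \<beta>)"
      "\<forall>U W. openin X U \<and> openin X W \<and> U \<subseteq> W \<longrightarrow> (\<forall>\<beta>\<in>Field r. F U \<beta> \<subseteq> F W \<beta>)"
      "\<forall>\<gamma> \<beta>. (\<gamma>, \<beta>) \<in> r - Id \<longrightarrow> (\<forall>U. openin X U \<longrightarrow> F U \<gamma> \<subseteq> F U \<beta>)"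
    using assms(2) unfolding semi_stratifiable_over_def by (elim conjE exE)
  have closed: "closedin X (F U \<beta>)" if "openin X U" "\<beta> \<in> Field r" for U \<beta>
    using F(1) that by blast
  have cover: "U = (\<Union>\<beta>\<in>Field r. F U \<beta>)" if "openin X U" for U
    using F(2) that by (elim allE impE)
  have mono: "F U \<beta> \<subseteq> F W \<beta>"
    if "openin X U" "openin X W" "U \<subseteq> W" "\<beta> \<in> Field r" for U W \<beta>
    using F(3) that by metis
  have incr: "F U \<gamma> \<subseteq> F U \<beta>" if "(\<gamma>, \<beta>) \<in> r - Id" "openin X U" for U \<gamma> \<beta>
    using F(4) that by metis
  show ?thesis
  proof (rule D_space_if_monotone_rank[OF assms(1) t1])
    fix N assume N: "ONA X N"
    have "\<exists>\<beta>. \<beta> \<in> Field r \<and> x \<in> F (N x) \<beta>" if "x \<in> topspace X" for x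
      using N that equalityD1[OF cover] unfolding ONA_def by blast
    then obtain n where n: "\<And>x. x \<in> topspace X \<Longrightarrow> n x \<in> Field r \<and> x \<in> F (N x) (n x)"
      by metis
    define g where "g x = topspace X - F (topspace X - {x}) (n x)" for x
    have op: "openin X (topspace X - {x})" for x
      using t1 by (simp add: t1_space_openin_delete_alt)
    \<comment> \<open>The sets \<open>F (topspace X - {x}) \<beta>\<close> have union
      \<open>topspace X - {x}\<close>, so none of them contains \<open>x\<close>.\<close>
    have "openin X (g x) \<and> x \<in> g x" if "x \<in> topspace X" for x
      using closed[OF op, of "n x" x] equalityD2[OF cover[OF op]] n[OF that] that
      unfolding g_def by blast
    moreover have "y \<notin> g x"
      if xy: "x \<in> topspace X" "y \<in> topspace X" "x \<notin> N y" "(n y, n x) \<in> r" for x y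
    proof -
      have "N y \<subseteq> topspace X - {x}" "openin X (N y)"
        using N xy openin_subset[of X "N y"] by (auto simp: ONA_def)
      then have "y \<in> F (topspace X - {x}) (n y)"
        using mono[of "N y" "topspace X - {x}" "n y"] n[OF xy(2)] op by blast
      then have "y \<in> F (topspace X - {x}) (n x)"
        \<comment> \<open>\<open>incr\<close> covers only strictly smaller indices, so equal ranks
          are a separate case.\<close>
        using incr[of "n y" "n x", OF _ op] xy(4) by (cases "n y = n x") auto
      then show ?thesis
        by (simp add: g_def)
    qed
    ultimately show "\<exists>n g. \<forall>x\<in>topspace X. n x \<in> Field r \<and> openin X (g x) \<and> x \<in> g x \<and>
        (\<forall>y\<in>topspace X. x \<notin> N y \<longrightarrow> (n y, n x) \<in> r \<longrightarrow> y \<notin> g x)"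
      using n by blast
  qed
qed

end
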